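(* Let $(L,[\cdot,\cdot]_1,[\cdot,\cdot]_2,\delta_1,\delta_2)$ be a compatible LieDer pair, and put $w_1(x,y)=[x,y]_1$, $w_2(x,y)=[x,y]_2$. For $n\ge1$ let $\mathcal{C}^n_{\mathrm{C.L.D}}(L,L)$ be the direct sum of $n$ copies of $\mathcal{C}^n_{\mathrm{LieDer}}(L,L)$, and define $\partial^n_{\mathrm{C.L.D.P}}:\mathcal{C}^n_{\mathrm{C.L.D}}(L,L)\to\mathcal{C}^{n+1}_{\mathrm{C.L.D}}(L,L)$ as follows. For $n=1$ and $f\in\mathrm{Hom}(L,L)$, $$\partial^1_{\mathrm{C.L.D.P}}(f)=\big(([w_1,f]_{\mathrm{NR}},-[f,\delta_1]_{\mathrm{NR}}),([w_2,f]_{\mathrm{NR}},-[f,\delta_2]_{\mathrm{NR}})\big).$$ For $n\ge2$, $\partial^n_{\mathrm{C.L.D.P}}\big((f^1,g^1),\ldots,(f^n,g^n)\big)$ is $(-1)^{n-1}$ times the $(n+1)$-tuple whose first entry is $$([w_1,f^1]_{\mathrm{NR}},\,-[w_1,g^1]_{\mathrm{NR}}-[f^1,\delta_1]_{\mathrm{NR}}),$$ whose $i$-th entry for $2\le i\le n$ is $$([w_2,f^{i-1}]_{\mathrm{NR}}+[w_1,f^i]_{\mathrm{NR}},\,-[w_2,g^{i-1}]_{\mathrm{NR}}-[w_1,g^i]_{\mathrm{NR}}-[f^{i-1},\delta_2]_{\mathrm{NR}}-[f^i,\delta_1]_{\mathrm{NR}}),$$ and whose $(n+1)$-st entry is $$([w_2,f^n]_{\mathrm{NR}},\,-[w_2,g^n]_{\mathrm{NR}}-[f^n,\delta_2]_{\mathrm{NR}}).$$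 Then $\partial^{\ast}_{\mathrm{C.L.D.P}}$ is a coboundary operator, i.e. $\partial^{n+1}_{\mathrm{C.L.D.P}}\circ\partial^n_{\mathrm{C.L.D.P}}=0$ for all $n\ge1$.
   Context: All vector spaces are over a field $\mathbb{K}$ of characteristic $0$. A LieDer pair $(L,[\cdot,\cdot],\delta)$ is a Lie algebra with a linear map $\delta:L\to L$ such that $\delta[x,y]=[\delta x,y]+[x,\delta y]$. A compatible LieDer pair $(L,[\cdot,\cdot]_1,[\cdot,\cdot]_2,\delta_1,\delta_2)$ consists of two LieDer pairs $(L,[\cdot,\cdot]_1,\delta_1)$, $(L,[\cdot,\cdot]_2,\delta_2)$ on the same vector space such that for all $x,y,z\in L$ (with $\circlearrowleft_{x,y,z}$ the sum over cyclic permutations of $x,y,z$): (1) $\circlearrowleft_{x,y,z}[x,[y,z]_1]_2+\circlearrowleft_{x,y,z}[x,[y,z]_2]_1=0$; (2) $\delta_1[x,y]_2+\delta_2[x,y]_1=[\delta_1x,y]_2+[x,\delta_1y]_2+[\delta_2x,y]_1+[x,\delta_2y]_1$. The Nijenhuis-Richardson bracket of $f\in\mathrm{Hom}(\wedge^{p+1}L,L)$ and $g\in\mathrm{Hom}(\wedge^{q+1}L,L)$ is $[f,g]_{\mathrm{NR}}=f\circ g-(-1)^{pq}g\circ f$, where $(f\circ g)(x_1,\ldots,x_{p+q+1})=\sum_{\sigma}\mathrm{sgn}(\sigma)f(g(x_{\sigma(1)},\ldots,x_{\sigma(q+1)}),x_{\sigma(q+2)},\ldots,x_{\sigma(p+q+1)})$,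 the sum being over $(q+1,p)$-shuffles. The spaces are $\mathcal{C}^1_{\mathrm{LieDer}}(L,L)=\mathrm{Hom}(L,L)$ and $\mathcal{C}^n_{\mathrm{LieDer}}(L,L)=\mathrm{Hom}(\wedge^nL,L)\times\mathrm{Hom}(\wedge^{n-1}L,L)$ for $n\ge2$. The space of $0$-cochains is $0$. *)

theory Defs
  imports
    Complex_Main
    "HOL-Combinatorics.Permutations"
    "HOL-Library.Function_Algebras"
    "HOL-Library.Product_Plus"
begin

definition cyclic_sum :: "('v \<Rightarrow> 'v \<Rightarrow> 'v \<Rightarrow> 'v) \<Rightarrow> 'v \<Rightarrow> 'v \<Rightarrow> 'v \<Rightarrow> 'v::ab_group_add"
  where "cyclic_sum F x y z = F x y z + F y z x + F z x y"

locale lie_algebra = vector_space scale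
  for scale :: "'k::field_char_0 \<Rightarrow> 'v::ab_group_add \<Rightarrow> 'v" +
  fixes br :: "'v \<Rightarrow> 'v \<Rightarrow> 'v"
  assumes linear_left: "Vector_Spaces.linear scale scale (\<lambda>x. br x y)"
    and linear_right: "Vector_Spaces.linear scale scale (\<lambda>y. br x y)"
    and bracket_self: "br x x = 0"
    and jacobi: "cyclic_sum (\<lambda>x y z. br x (br y z)) x y z = 0"

locale LieDer_pair = lie_algebra scale br
  for scale :: "'k::field_char_0 \<Rightarrow> 'v::ab_group_add \<Rightarrow> 'v" and br +
  fixes \<delta> :: "'v \<Rightarrow> 'v"
  assumes linear_derivation: "Vector_Spaces.linear scale scale \<delta>"
    and leibniz: "\<delta> (br x y) = br (\<delta> x) y + br x (\<delta> y)"

locale compatible_LieDer_pair =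
  p1: LieDer_pair scale br1 \<delta>1 + p2: LieDer_pair scale br2 \<delta>2
  for scale :: "'k::field_char_0 \<Rightarrow> 'v::ab_group_add \<Rightarrow> 'v" and br1 br2 \<delta>1 \<delta>2 +
  assumes compatible_brackets:
      "cyclic_sum (\<lambda>x y z. br2 x (br1 y z)) x y z + cyclic_sum (\<lambda>x y z. br1 x (br2 y z)) x y z = 0"
    and compatible_derivations:
      "\<delta>1 (br2 x y) + \<delta>2 (br1 x y) =
         br2 (\<delta>1 x) y + br2 x (\<delta>1 y) + br1 (\<delta>2 x) y + br1 x (\<delta>2 y)"

text \<open>
  A map of \<open>n\<close> arguments in \<open>L\<close> is encoded as a function of an infinite sequence of arguments,
  counted from 0, that depends on the first \<open>n\<close> entries only. Equality of such functions is
  equality of the maps, and sums, negatives and 0 are the pointwise ones.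
  The set \<open>Hom_wedge scale n\<close> is \<open>Hom(\<Lambda>\<^sup>n L, L)\<close>.
\<close>

type_synonym 'v form = "(nat \<Rightarrow> 'v) \<Rightarrow> 'v"

definition Hom_wedge :: "('k::field_char_0 \<Rightarrow> 'v::ab_group_add \<Rightarrow> 'v) \<Rightarrow> nat \<Rightarrow> 'v form set"
  where "Hom_wedge scale n =
    {f. (\<forall>x y. (\<forall>i<n. x i = y i) \<longrightarrow> f x = f y) \<and>
        (\<forall>x. \<forall>i<n. Vector_Spaces.linear scale scale (\<lambda>v. f (x(i := v)))) \<and>
        (\<forall>x i j. i < j \<and> j < n \<and> x i = x j \<longrightarrow> f x = 0)}"

definition form1 :: "('v \<Rightarrow> 'v) \<Rightarrow> 'v form"
  where "form1 \<delta> x = \<delta> (x 0)"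

definition form2 :: "('v \<Rightarrow> 'v \<Rightarrow> 'v) \<Rightarrow> 'v form"
  where "form2 br x = br (x 0) (x 1)"

definition scale_form :: "('k \<Rightarrow> 'v \<Rightarrow> 'v) \<Rightarrow> 'k \<Rightarrow> 'v form \<Rightarrow> 'v form"
  where "scale_form scale a f x = scale a (f x)"

definition unshuffles :: "nat \<Rightarrow> nat \<Rightarrow> (nat \<Rightarrow> nat) set"
  where "unshuffles a b =
    {\<sigma>. \<sigma> permutes {..<a + b} \<and> strict_mono_on {..<a} \<sigma> \<and> strict_mono_on {a..<a + b} \<sigma>}"

text \<open>
  For \<open>f\<close> in \<open>Hom_wedge scale (p + 1)\<close> and \<open>g\<close> in \<open>Hom_wedge scale (q + 1)\<close>. The argument of
  \<open>f\<close> below is the sequence \<open>g (x\<^bsub>\<sigma> 0\<^esub>, \<dots>, x\<^bsub>\<sigma> q\<^esub>), x\<^bsub>\<sigma> (q + 1)\<^esub>, x\<^bsub>\<sigma> (q + 2)\<^esub>, \<dots>\<close>,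
  of which \<open>f\<close> reads the first \<open>p + 1\<close> entries.
\<close>

definition NR_comp ::
  "('k::field_char_0 \<Rightarrow> 'v::ab_group_add \<Rightarrow> 'v) \<Rightarrow> nat \<Rightarrow> nat \<Rightarrow> 'v form \<Rightarrow> 'v form \<Rightarrow> 'v form"
  where "NR_comp scale p q f g x =
    (\<Sum>\<sigma>\<in>unshuffles (q + 1) p.
       scale (of_int (sign \<sigma>))
         (f (case_nat (g (\<lambda>i. x (\<sigma> i))) (\<lambda>i. x (\<sigma> (q + 1 + i))))))"

definition NR_bracket ::
  "('k::field_char_0 \<Rightarrow> 'v::ab_group_add \<Rightarrow> 'v) \<Rightarrow> nat \<Rightarrow> nat \<Rightarrow> 'v form \<Rightarrow> 'v form \<Rightarrow> 'v form"
  where "NR_bracket scale p q f g =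
    NR_comp scale p q f g - scale_form scale ((- 1) ^ (p * q)) (NR_comp scale q p g f)"

text \<open>
  Cochains of every degree are pairs. In degree 1 the second component is forced to be 0, so that
  the space of 1-cochains is a copy of \<open>Hom(L, L)\<close>.
\<close>

definition C_LieDer ::
  "('k::field_char_0 \<Rightarrow> 'v::ab_group_add \<Rightarrow> 'v) \<Rightarrow> nat \<Rightarrow> ('v form \<times> 'v form) set"
  where "C_LieDer scale n =
    Hom_wedge scale n \<times> (if n = 1 then {0} else Hom_wedge scale (n - 1))"

definition C_CLD ::
  "('k::field_char_0 \<Rightarrow> 'v::ab_group_add \<Rightarrow> 'v) \<Rightarrow> nat \<Rightarrow> ('v form \<times> 'v form) list set"
  where "C_CLD scale n = {c. length c = n \<and> set c \<subseteq> C_LieDer scale n}"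

text \<open>
  Here \<open>f i\<close> and \<open>g i\<close> for \<open>1 \<le> i \<le> n\<close> are the components of the \<open>i\<close>-th entry of the
  cochain, while list positions start at 0. The Nijenhuis-Richardson degree of an element of
  \<open>Hom(\<Lambda>\<^sup>n L, L)\<close> is \<open>n - 1\<close>.
\<close>

definition d_CLDP ::
  "('k::field_char_0 \<Rightarrow> 'v::ab_group_add \<Rightarrow> 'v) \<Rightarrow> ('v \<Rightarrow> 'v \<Rightarrow> 'v) \<Rightarrow> ('v \<Rightarrow> 'v \<Rightarrow> 'v) \<Rightarrow>
   ('v \<Rightarrow> 'v) \<Rightarrow> ('v \<Rightarrow> 'v) \<Rightarrow> nat \<Rightarrow> ('v form \<times> 'v form) list \<Rightarrow> ('v form \<times> 'v form) list"
  where "d_CLDP scale br1 br2 \<delta>1 \<delta>2 n c =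
    (let w1 = form2 br1; w2 = form2 br2; D1 = form1 \<delta>1; D2 = form1 \<delta>2;
         NR = NR_bracket scale;
         f = (\<lambda>i. fst (c ! (i - 1))); g = (\<lambda>i. snd (c ! (i - 1)))
     in if n = 1 then
          [(NR 1 0 w1 (f 1), - NR 0 0 (f 1) D1),
           (NR 1 0 w2 (f 1), - NR 0 0 (f 1) D2)]
        else
          map (map_prod (scale_form scale ((- 1) ^ (n - 1))) (scale_form scale ((- 1) ^ (n - 1))))
            ([(NR 1 (n - 1) w1 (f 1),
               - NR 1 (n - 2) w1 (g 1) - NR (n - 1) 0 (f 1) D1)] @
             map (\<lambda>i.
               (NR 1 (n - 1) w2 (f (i - 1)) + NR 1 (n - 1) w1 (f i),
                - NR 1 (n - 2) w2 (g (i - 1)) - NR 1 (n - 2) w1 (g i)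
                - NR (n - 1) 0 (f (i - 1)) D2 - NR (n - 1) 0 (f i) D1)) [2..<n + 1] @
             [(NR 1 (n - 1) w2 (f n),
               - NR 1 (n - 2) w2 (g n) - NR (n - 1) 0 (f n) D2)]))"

end

theory Submission
  imports Defs
begin

text \<open>
  Everything is deduced from the Cartan calculus of a single LieDer pair. Let \<open>\<iota>\<^sub>v\<close> insert \<open>v\<close> as
  first argument, let \<open>L\<^sub>\<delta> f = [f, \<delta>]\<close> and \<open>d f = \<plusminus>[w, f]\<close>. Splitting shuffles according to the position
  of the first argument gives \<open>\<iota>\<^sub>v L\<^sub>\<delta> = L\<^sub>\<delta> \<iota>\<^sub>v + \<iota>\<^bsub>\<delta> v\<^esub>\<close> and \<open>\<iota>\<^sub>v d + d \<iota>\<^sub>v = L\<^bsub>w(v, -)\<^esub>\<close>. As a form is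
  determined by its contractions, \<open>L\<^sub>\<delta> d = d L\<^sub>\<delta>\<close> for a derivation \<open>\<delta>\<close> and then \<open>d d = 0\<close> (using the
  derivation \<open>w(v, -)\<close>) follow by induction on the arity. The mixed identities are obtained by
  polarisation: the sum of the two compatible LieDer pairs is again a LieDer pair.
\<close>

subsection \<open>Cartan calculus\<close>

text \<open>
  As simplification rules these would rewrite eta-expanded sums and zeros of forms, as produced
  by induction, into abstractions.
\<close>

lemmas pointwise = plus_fun_apply zero_fun_apply minus_apply uminus_apply

declare pointwise [simp del]

definition ctr :: "'v \<Rightarrow> 'v form \<Rightarrow> 'v form"
  where "ctr v f = (\<lambda>y. f (case_nat v y))"

lemma ctr_apply: "ctr (x 0) f (x \<circ> Suc) = f x"
proof -
  have "case_nat (x 0) (x \<circ> Suc) = x"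
    by (auto simp: fun_eq_iff split: nat.split)
  then show ?thesis by (simp add: ctr_def)
qed

text \<open>A sequence is its head followed by its tail, so the contractions together see every
  argument. This reduces the identities below to smaller arity, ready for induction.\<close>

lemma form_eqI: "f = g" if "\<And>v. ctr v f = ctr v g"
  using that by (metis ctr_apply ext)

lemma ctr_add [simp]: "ctr v (f + g) = ctr v f + ctr v g"
  and ctr_diff [simp]: "ctr v (f - g) = ctr v f - ctr v g"
  and ctr_zero [simp]: "ctr v 0 = 0"
  and ctr_scale_form [simp]: "ctr v (scale_form scale a f) = scale_form scale a (ctr v f)"
  by (auto simp: ctr_def scale_form_def pointwise)

text \<open>
  Up to sign, \<open>Lie n \<delta> f\<close> and \<open>CE w n f\<close> are the Nijenhuis-Richardson brackets \<open>[f, \<delta>]\<close> and \<open>[w, f]\<close>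
  for \<open>f\<close> of arity \<open>n\<close>; the recursions make sense in arity 0 too, where the inductions start.
\<close>

primrec Lie :: "nat \<Rightarrow> ('v \<Rightarrow> 'v) \<Rightarrow> 'v form \<Rightarrow> 'v::ab_group_add form"
  where "Lie 0 \<delta> f = (\<lambda>x. - \<delta> (f x))"
  | "Lie (Suc n) \<delta> f =
      (\<lambda>x. Lie n \<delta> (ctr (x 0) f) (x \<circ> Suc) + ctr (\<delta> (x 0)) f (x \<circ> Suc))"

primrec CE :: "('v \<Rightarrow> 'v \<Rightarrow> 'v) \<Rightarrow> nat \<Rightarrow> 'v form \<Rightarrow> 'v::ab_group_add form"
  where "CE w 0 f = (\<lambda>x. w (f x) (x 0))"
  | "CE w (Suc n) f =
      (\<lambda>x. Lie (Suc n) (w (x 0)) f (x \<circ> Suc) - CE w n (ctr (x 0) f) (x \<circ> Suc))"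

lemma case_nat_Suc_comp [simp]: "case_nat v y \<circ> Suc = y"
  by (simp add: pointwise fun_eq_iff)

lemma ctr_Lie: "ctr v (Lie (Suc n) \<delta> f) = Lie n \<delta> (ctr v f) + ctr (\<delta> v) f"
  by (subst ctr_def) (simp add: pointwise fun_eq_iff)

lemma ctr_CE: "ctr v (CE w (Suc n) f) = Lie (Suc n) (w v) f - CE w n (ctr v f)"
  by (subst ctr_def) (simp only: CE.simps case_nat_Suc_comp fun_eq_iff nat.case minus_apply simp_thms pointwise)

declare Lie.simps(2) [simp del] CE.simps(2) [simp del]

section \<open>Alternating forms by recursion on the arity, and the operator \<open>Lie\<close> on
  them\<close>

locale vector_space_char_0 = vector_space scale
  for scale :: "'k::field_char_0 \<Rightarrow> 'v::ab_group_add \<Rightarrow> 'v"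
begin

abbreviation lin :: "('v \<Rightarrow> 'v) \<Rightarrow> bool"
  where "lin \<equiv> Vector_Spaces.linear scale scale"

abbreviation sform :: "'k \<Rightarrow> 'v form \<Rightarrow> 'v form"
  where "sform \<equiv> scale_form scale"

lemma lin_iff: "lin f \<longleftrightarrow> (\<forall>x y. f (x + y) = f x + f y) \<and> (\<forall>a x. f (scale a x) = scale a (f x))"
  using vector_space_axioms by (simp add: Vector_Spaces.linear_iff)

lemma linD:
  assumes "lin f"
  shows "f (x + y) = f x + f y" "f (scale a x) = scale a (f x)"
    "f 0 = 0" "f (- x) = - f x" "f (x - y) = f x - f y"
proof -
  interpret Vector_Spaces.linear scale scale f by fact
  show "f (x + y) = f x + f y" "f (scale a x) = scale a (f x)"
    "f 0 = 0" "f (- x) = - f x" "f (x - y) = f x - f y"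
    by (simp_all add: add scale zero neg diff)
qed

lemma sform_simps:
  "sform a (f + g) = sform a f + sform a g" "sform a (f - g) = sform a f - sform a g"
  "sform a (- f) = - sform a f" "sform a 0 = 0" "sform 1 f = f"
  "sform a (sform b f) = sform (a * b) f"
  by (auto simp: pointwise scale_form_def fun_eq_iff scale_right_distrib scale_right_diff_distrib)

text \<open>A recursive rendering of \<open>Hom_wedge\<close>, see \<open>Hom_wedge_iff\<close>:
  each level constrains the leading arguments only, and the levels below take care of the others.
  The guard \<open>n > 0\<close> is there because a form of arity 1 has no second argument to
  repeat.\<close>

primrec alt :: "nat \<Rightarrow> 'v form \<Rightarrow> bool"
  where "alt 0 f \<longleftrightarrow> (\<forall>x y. f x = f y)"
  | "alt (Suc n) f \<longleftrightarrow>
      (\<forall>v. alt n (ctr v f)) \<and>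
      (\<forall>u v. ctr (u + v) f = ctr u f + ctr v f) \<and>
      (\<forall>a v. ctr (scale a v) f = sform a (ctr v f)) \<and>
      (n > 0 \<longrightarrow> (\<forall>v. ctr v (ctr v f) = 0))"

lemma ctr_alt:
  assumes "alt (Suc n) f"
  shows "alt n (ctr v f)" "ctr (u + v) f = ctr u f + ctr v f"
    "ctr (scale a v) f = sform a (ctr v f)" "n > 0 \<Longrightarrow> ctr v (ctr v f) = 0"
  using assms by auto

lemma ctr_alt_diff:
  assumes "alt (Suc n) f"
  shows "ctr (u - v) f = ctr u f - ctr v f"
  using ctr_alt(2)[OF assms, of "u - v" v] by simp

lemma ctr_alt_zero:
  assumes "alt (Suc n) f"
  shows "ctr 0 f = 0"
  using ctr_alt(2)[OF assms, of 0 0] by simp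

text \<open>Polarisation: expand the vanishing double contraction with \<open>u + v\<close>.\<close>

lemma ctr_swap:
  assumes "alt (Suc (Suc n)) f"
  shows "ctr u (ctr v f) = - ctr v (ctr u f)"
proof -
  have "ctr (u + v) (ctr (u + v) f) = 0" "ctr u (ctr u f) = 0" "ctr v (ctr v f) = 0"
    using ctr_alt(4)[OF assms] by blast+
  moreover have "ctr (u + v) (ctr (u + v) f) =
      ctr u (ctr u f) + ctr u (ctr v f) + (ctr v (ctr u f) + ctr v (ctr v f))"
    by (simp add: ctr_alt(2)[OF assms] ctr_alt(2)[OF ctr_alt(1)[OF assms]] algebra_simps)
  ultimately show ?thesis by (simp add: eq_neg_iff_add_eq_0)
qed

lemma alt_zero [simp]: "alt n 0"
proof (induction n)
  case 0
  then show ?case by (simp add: pointwise)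
qed (simp add: sform_simps)

lemma alt_add: "alt n f \<Longrightarrow> alt n g \<Longrightarrow> alt n (f + g)"
proof (induction n arbitrary: f g)
  case 0
  then show ?case by (metis alt.simps(1) plus_fun_apply)
next
  case (Suc n)
  then show ?case by (auto simp: sform_simps algebra_simps)
qed

lemma alt_sform: "alt n f \<Longrightarrow> alt n (sform a f)"
proof (induction n arbitrary: f)
  case 0
  then show ?case by (metis alt.simps(1) scale_form_def)
next
  case (Suc n)
  then show ?case by (auto simp: sform_simps mult.commute)
qed

lemma uminus_sform: "- f = sform (-1) f"
  by (auto simp: pointwise scale_form_def fun_eq_iff)

lemma alt_uminus: "alt n f \<Longrightarrow> alt n (- f)"
  by (metis uminus_sform alt_sform)

lemma alt_diff: "alt n f \<Longrightarrow> alt n g \<Longrightarrow> alt n (f - g)"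
  by (metis alt_add alt_uminus add_uminus_conv_diff)

lemma Lie_add: "lin \<delta> \<Longrightarrow> Lie n \<delta> (f + g) = Lie n \<delta> f + Lie n \<delta> g"
proof (induction n arbitrary: f g)
  case 0
  then show ?case by (simp add: pointwise fun_eq_iff linD)
next
  case (Suc n)
  show ?case by (rule form_eqI) (simp add: ctr_Lie Suc)
qed

lemma Lie_sform: "lin \<delta> \<Longrightarrow> Lie n \<delta> (sform a f) = sform a (Lie n \<delta> f)"
proof (induction n arbitrary: f)
  case 0
  then show ?case by (simp add: pointwise fun_eq_iff scale_form_def linD)
next
  case (Suc n)
  show ?case by (rule form_eqI) (simp add: ctr_Lie Suc sform_simps)
qed

lemma Lie_uminus: "lin \<delta> \<Longrightarrow> Lie n \<delta> (- f) = - Lie n \<delta> f"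
  by (simp add: uminus_sform Lie_sform)

lemma Lie_diff: "lin \<delta> \<Longrightarrow> Lie n \<delta> (f - g) = Lie n \<delta> f - Lie n \<delta> g"
  by (metis Lie_add Lie_uminus add_uminus_conv_diff)

lemma Lie_zero [simp]: "lin \<delta> \<Longrightarrow> Lie n \<delta> 0 = 0"
  using Lie_add[of \<delta> n 0 0] by simp

text \<open>The map enters through contractions with its values, so additivity in it rests on
  additivity of \<open>f\<close> in its first argument.\<close>

lemma Lie_add_left:
  "alt n f \<Longrightarrow> Lie n (\<lambda>x. \<delta> x + \<epsilon> x) f = Lie n \<delta> f + Lie n \<epsilon> f"
proof (induction n arbitrary: f)
  case 0
  then show ?case by (simp add: pointwise fun_eq_iff)
next
  case (Suc n)
  show ?case
    by (rule form_eqI) (simp add: ctr_Lie Suc.IH ctr_alt[OF Suc.prems])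
qed

lemma Lie_scale_left:
  "alt n f \<Longrightarrow> Lie n (\<lambda>x. scale a (\<delta> x)) f = sform a (Lie n \<delta> f)"
proof (induction n arbitrary: f)
  case 0
  then show ?case by (simp add: pointwise fun_eq_iff scale_form_def)
next
  case (Suc n)
  show ?case
    by (rule form_eqI) (simp add: ctr_Lie Suc.IH ctr_alt[OF Suc.prems] sform_simps)
qed

lemma alt_Lie:
  assumes \<delta>: "lin \<delta>"
  shows "alt n f \<Longrightarrow> alt n (Lie n \<delta> f)"
proof (induction n arbitrary: f)
  case 0
  then show ?case by (auto intro: arg_cong)
next
  case (Suc n)
  note f = Suc.prems
  \<comment> \<open>Contracting twice gives \<open>Lie\<close> of a repeated contraction, which is
    0, and two terms pairing \<open>v\<close> with \<open>\<delta> v\<close>, which cancel by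
    \<open>ctr_swap\<close>.\<close>
  have "ctr v (ctr v (Lie (Suc n) \<delta> f)) = 0" if n: "n > 0" for v
  proof -
    obtain m where m: "n = Suc m" using n by (cases n) auto
    show ?thesis
      using f ctr_alt(4)[OF f n] ctr_swap[OF f[unfolded m], of v "\<delta> v"]
      by (simp add: m ctr_Lie \<delta>)
  qed
  then show ?case
    using Suc.IH[OF ctr_alt(1)[OF f]] ctr_alt[OF f]
    by (auto simp: ctr_Lie linD[OF \<delta>] Lie_add[OF \<delta>] Lie_sform[OF \<delta>] alt_add sform_simps)
qed

text \<open>\<open>Lie\<close> is the right action of endomorphisms on forms, hence reverses
  commutators.\<close>

lemma Lie_commutator:
  assumes "lin \<delta>" "lin \<epsilon>"
  shows "alt n f \<Longrightarrow>
    Lie n \<delta> (Lie n \<epsilon> f) + Lie n (\<lambda>v. \<delta> (\<epsilon> v) - \<epsilon> (\<delta> v)) f = Lie n \<epsilon> (Lie n \<delta> f)"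
proof (induction n arbitrary: f)
  case 0
  then show ?case by (simp add: pointwise fun_eq_iff linD[OF assms(1)] linD[OF assms(2)])
next
  case (Suc n)
  show ?case
    by (rule form_eqI)
      (simp add: ctr_Lie Lie_add assms ctr_alt_diff[OF Suc.prems]
        Suc.IH[OF ctr_alt(1)[OF Suc.prems], symmetric])
qed

end

section \<open>The Chevalley-Eilenberg differential of a Lie algebra\<close>

sublocale lie_algebra \<subseteq> vector_space_char_0 ..

context lie_algebra
begin

abbreviation d :: "nat \<Rightarrow> 'v form \<Rightarrow> 'v form"
  where "d \<equiv> CE br"

lemma lin_br: "lin (br x)" "lin (\<lambda>x. br x y)"
  using linear_left linear_right by auto

lemma br_simps:
  "br (x + y) z = br x z + br y z" "br (x - y) z = br x z - br y z" "br (- x) z = - br x z"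
  "br (scale a x) z = scale a (br x z)" "br 0 z = 0"
  "br z (x + y) = br z x + br z y" "br z (x - y) = br z x - br z y" "br z (- x) = - br z x"
  "br z (scale a x) = scale a (br z x)" "br z 0 = 0"
  using linD[OF lin_br(1)] linD[OF lin_br(2)] by auto

lemma br_swap: "br x y = - br y x"
proof -
  have "br x y + br y x = br (x + y) (x + y)"
    by (simp add: br_simps bracket_self[of x] bracket_self[of y])
  then show ?thesis
    by (simp only: bracket_self eq_neg_iff_add_eq_0)
qed

text \<open>The Jacobi identity in the form that makes each \<open>br x\<close> a
  derivation.\<close>

lemma br_br: "br (br x y) z = br x (br y z) - br y (br x z)"
proof -
  have "br x (br y z) + br y (br z x) + br z (br x y) = 0"
    using jacobi[of x y z] by (simp add: cyclic_sum_def)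
  then have "- br z (br x y) = br x (br y z) + br y (br z x)"
    by (metis minus_unique add.commute)
  then show ?thesis
    using br_swap[of "br x y" z] br_swap[of x z] by (simp add: br_simps)
qed

lemma d_add: "d n (f + g) = d n f + d n g"
proof (induction n arbitrary: f g)
  case 0
  then show ?case by (simp add: pointwise fun_eq_iff br_simps)
next
  case (Suc n)
  show ?case by (rule form_eqI) (simp add: ctr_CE Suc Lie_add lin_br)
qed

lemma d_sform: "d n (sform a f) = sform a (d n f)"
proof (induction n arbitrary: f)
  case 0
  then show ?case by (simp add: pointwise fun_eq_iff br_simps scale_form_def)
next
  case (Suc n)
  show ?case by (rule form_eqI) (simp add: ctr_CE Suc Lie_sform lin_br sform_simps)
qed

lemma d_uminus: "d n (- f) = - d n f"
  by (simp add: uminus_sform d_sform)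

lemma d_diff: "d n (f - g) = d n f - d n g"
  by (metis d_add d_uminus add_uminus_conv_diff)

lemma d_zero [simp]: "d n 0 = 0"
  using d_add[of n 0 0] by simp

lemma alt_d: "alt n f \<Longrightarrow> alt (Suc n) (d n f)"
proof (induction n arbitrary: f)
  case 0
  then have "f x = f y" for x y by simp
  then show ?case
    by (auto simp: ctr_def br_simps scale_form_def fun_eq_iff pointwise) metis+
next
  case (Suc n)
  note f = Suc.prems
  have alt: "ctr v (ctr v (d (Suc n) f)) = 0" for v
  \<comment> \<open>For \<open>n = 0\<close> the term \<open>d 0 (ctr v f)\<close> is outside the
    scope of \<open>ctr_CE\<close> and is evaluated directly. Otherwise the \<open>Lie\<close> terms
    cancel, leaving \<open>ctr (br v v) f\<close> and \<open>d\<close> of a repeated contraction,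
    both 0.\<close>
  proof (cases n)
    case 0
    have "ctr v f (case_nat v x) = ctr v f x" for x
      using f 0 by simp
    then show ?thesis
      using 0 ctr_alt(3)[OF f, of 0 v]
      by (simp add: ctr_CE ctr_Lie bracket_self, simp add: ctr_def bracket_self pointwise fun_eq_iff scale_form_def)
        (metis br_swap)
  next
    case (Suc m)
    then show ?thesis
      using ctr_alt(4)[OF f] by (simp add: ctr_CE ctr_Lie bracket_self ctr_alt_zero[OF f])
  qed
  have 1: "alt (Suc n) (ctr v (d (Suc n) f))" for v
    unfolding ctr_CE by (intro alt_diff alt_Lie lin_br Suc.IH ctr_alt(1)[OF f] f)
  have 2: "ctr (u + v) (d (Suc n) f) = ctr u (d (Suc n) f) + ctr v (d (Suc n) f)" for u v
    using Lie_add_left[OF f, of "br u" "br v"]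
    by (simp add: ctr_CE ctr_alt(2)[OF f] d_add br_simps(1)[abs_def])
  have 3: "ctr (scale a v) (d (Suc n) f) = sform a (ctr v (d (Suc n) f))" for a v
    using Lie_scale_left[OF f, of a "br v"]
    by (simp add: ctr_CE ctr_alt(3)[OF f] d_sform sform_simps br_simps(4)[abs_def])
  show ?case
    unfolding alt.simps(2)[of "Suc n"] using 1 2 3 alt by blast
qed

end

context LieDer_pair
begin

lemma Lie_d: "alt n f \<Longrightarrow> Lie (Suc n) \<delta> (d n f) = d n (Lie n \<delta> f)"
proof (induction n arbitrary: f)
  case 0
  \<comment> \<open>A form of arity 0 is constant, so its value may be read at any point.\<close>
  then have "f = (\<lambda>_. f undefined)" by auto
  then obtain u where f: "f = (\<lambda>_. u)" ..
  show ?case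
    by (rule form_eqI)
      (simp add: ctr_Lie, simp add: f ctr_def pointwise fun_eq_iff leibniz br_simps)
next
  case (Suc n)
  note f = Suc.prems
  \<comment> \<open>The Leibniz rule as a commutator of endomorphisms; \<open>Lie_commutator\<close>
    then supplies exactly the discrepancy between the two contracted sides.\<close>
  have "(\<lambda>u. \<delta> (br v u) - br v (\<delta> u)) = br (\<delta> v)" for v
    by (simp add: leibniz)
  then have comm: "Lie (Suc n) (br v) (Lie (Suc n) \<delta> f) =
      Lie (Suc n) \<delta> (Lie (Suc n) (br v) f) + Lie (Suc n) (br (\<delta> v)) f" for v
    using Lie_commutator[OF linear_derivation lin_br(1)[of v] f] by simp
  show ?case
    by (rule form_eqI)
      (simp only: ctr_Lie ctr_CE comm Lie_diff[OF linear_derivation] d_add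
        Suc.IH[OF ctr_alt(1)[OF f]], simp)
qed

end

context lie_algebra
begin

text \<open>Inner derivations: they allow \<open>Lie_d\<close> to be used in a Lie algebra without a
  given derivation.\<close>

lemma LieDer_pair_br: "LieDer_pair scale br (br v)"
  by unfold_locales (use br_br lin_br in \<open>auto simp: linD\<close>)

text \<open>Contraction with \<open>v\<close> leaves the commutator of \<open>Lie\<close> along
  \<open>br v\<close> with \<open>d\<close>, which is 0 by \<open>Lie_d\<close>, and
  \<open>d d\<close> of \<open>ctr v f\<close>. In arity 0 two contractions reduce the claim to
  Jacobi.\<close>

lemma d_d: "alt n f \<Longrightarrow> d (Suc n) (d n f) = 0"
proof (induction n arbitrary: f)
  case 0
  then have "f = (\<lambda>_. f undefined)" by auto
  then obtain u where f: "f = (\<lambda>_. u)" ..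
  show ?case
    by (rule form_eqI)
      (simp add: ctr_CE, rule form_eqI, simp add: ctr_Lie,
        simp add: f ctr_def pointwise fun_eq_iff br_br br_simps)
next
  case (Suc n)
  note f = Suc.prems
  show ?case
    by (rule form_eqI)
      (simp only: ctr_CE d_diff LieDer_pair.Lie_d[OF LieDer_pair_br f]
        Suc.IH[OF ctr_alt(1)[OF f]], simp add: ctr_CE)
qed

end

text \<open>\<open>NR_comp\<close> indexed by the sizes of the two blocks, so that the block fed to
  \<open>g\<close> may become empty in the recursion.\<close>

definition shuffle_comp ::
  "('k::field_char_0 \<Rightarrow> 'v::ab_group_add \<Rightarrow> 'v) \<Rightarrow> nat \<Rightarrow> nat \<Rightarrow> 'v form \<Rightarrow> 'v form \<Rightarrow> 'v form"
  where "shuffle_comp scale a b f g x =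
    (\<Sum>\<sigma>\<in>unshuffles a b.
       scale (of_int (sign \<sigma>)) (f (case_nat (g (\<lambda>i. x (\<sigma> i))) (\<lambda>i. x (\<sigma> (a + i))))))"

lemma NR_comp_eq: "NR_comp scale p q f g = shuffle_comp scale (Suc q) p f g"
  by (simp add: fun_eq_iff NR_comp_def shuffle_comp_def)

subsection \<open>Unshuffles by the position of 0\<close>

definition shift :: "(nat \<Rightarrow> nat) \<Rightarrow> nat \<Rightarrow> nat"
  where "shift \<tau> = case_nat 0 (Suc \<circ> \<tau>)"

lemma shift_simps [simp]: "shift \<tau> 0 = 0" "shift \<tau> (Suc i) = Suc (\<tau> i)"
  by (simp_all add: shift_def)

lemma permutes_shift_iff: "shift \<tau> permutes {..<Suc n} \<longleftrightarrow> \<tau> permutes {..<n}"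
proof
  assume *: "shift \<tau> permutes {..<Suc n}"
  have "\<tau> x = x" if "x \<notin> {..<n}" for x
    using permutes_not_in[OF *, of "Suc x"] that by simp
  moreover have "\<exists>!x. \<tau> x = y" for y
  proof -
    obtain z where z: "shift \<tau> z = Suc y"
      using permutes_surj[OF *] by (metis surjD)
    then obtain x where "z = Suc x" by (cases z) auto
    then have "\<tau> x = y" using z by simp
    moreover have "x' = x" if "\<tau> x' = y" for x'
      using permutes_inj[OF *, THEN injD, of "Suc x'" "Suc x"] that \<open>\<tau> x = y\<close> by simp
    ultimately show ?thesis by blast
  qed
  ultimately show "\<tau> permutes {..<n}"
    by (simp add: permutes_def)
next
  assume *: "\<tau> permutes {..<n}"
  have "shift \<tau> x = x" if "x \<notin> {..<Suc n}" for x
    using permutes_not_in[OF *, of "x - 1"] that by (cases x) auto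
  moreover have "\<exists>!x. shift \<tau> x = y" for y
  proof (cases y)
    case 0
    then show ?thesis by (metis nat.exhaust nat.distinct(1) shift_simps)
  next
    case (Suc z)
    obtain x where "\<tau> x = z"
      using permutes_surj[OF *] by (metis surjD)
    then have "shift \<tau> (Suc x) = y" using Suc by simp
    moreover have "x' = Suc x" if "shift \<tau> x' = y" for x'
      using permutes_inj[OF *, THEN injD, of "x' - 1" x] that \<open>\<tau> x = z\<close> Suc by (cases x') auto
    ultimately show ?thesis by blast
  qed
  ultimately show "shift \<tau> permutes {..<Suc n}"
    by (simp add: permutes_def)
qed

text \<open>\<open>shift \<tau>\<close> is \<open>\<tau>\<close> transported along the injection
  \<open>Suc\<close>, and transport preserves signs.\<close>

lemma sign_shift:
  assumes "\<tau> permutes {..<n}"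
  shows "sign (shift \<tau>) = sign \<tau>"
proof -
  have "shift \<tau> x = map_permutation {..<n} Suc \<tau> x" for x
  proof (cases x)
    case 0
    then show ?thesis by (auto simp: map_permutation_def restrict_id_def)
  next
    case (Suc i)
    have "inv_into {..<n} Suc (Suc i) = i" if "i < n"
      using that by (simp add: inv_into_f_f)
    then show ?thesis
      using Suc permutes_not_in[OF assms, of i]
      by (auto simp: map_permutation_def restrict_id_def)
  qed
  then have "shift \<tau> = map_permutation {..<n} Suc \<tau>" by blast
  then show ?thesis
    using assms by (simp add: sign_map_permutation)
qed

text \<open>The cycle of 0, ..., \<open>m\<close>. Composing \<open>shift \<tau>\<close> with it
  moves the value 0 to position \<open>m\<close>; with \<open>m = Suc a\<close> this is the head of
  the second block.\<close>

definition cyc :: "nat \<Rightarrow> nat \<Rightarrow> nat"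
  where "cyc m i = (if i < m then Suc i else if i = m then 0 else i)"

lemma cyc_Suc: "cyc (Suc m) = cyc m \<circ> transpose m (Suc m)"
  by (auto simp: fun_eq_iff cyc_def transpose_def)

lemma cyc_0: "cyc 0 = id"
  by (auto simp: fun_eq_iff cyc_def)

lemma permutes_cyc: "m < n \<Longrightarrow> cyc m permutes {..<n}"
proof (induction m)
  case 0
  then show ?case unfolding cyc_0 by (intro permutes_id)
next
  case (Suc m)
  then show ?case
    unfolding cyc_Suc by (intro permutes_compose permutes_swap_id) auto
qed

lemma sign_cyc: "sign (cyc m) = (- 1) ^ m"
proof (induction m)
  case 0
  then show ?case unfolding cyc_0 by simp
next
  case (Suc m)
  have "permutation (cyc m)"
    using permutes_cyc[of m "Suc m"] by (auto simp: permutation_permutes)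
  then show ?case
    using Suc unfolding cyc_Suc by (subst sign_compose) (simp_all add: permutation_swap_id sign_swap_id)
qed

lemma unshuffles_permutes: "\<sigma> \<in> unshuffles a b \<Longrightarrow> \<sigma> permutes {..<a + b}"
  by (simp add: unshuffles_def)

lemma finite_unshuffles: "finite (unshuffles a b)"
  by (rule finite_subset[OF _ finite_permutations[of "{..<a + b}"]]) (auto simp: unshuffles_def)

lemma shift_unshuffles:
  assumes "\<tau> \<in> unshuffles a (Suc b)"
  shows "shift \<tau> \<in> unshuffles (Suc a) (Suc b)"
proof -
  have *: "\<tau> permutes {..<a + Suc b}" "strict_mono_on {..<a} \<tau>" "strict_mono_on {a..<a + Suc b} \<tau>"
    using assms by (auto simp: unshuffles_def)
  have "strict_mono_on {..<Suc a} (shift \<tau>)"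
  proof (rule strict_mono_onI)
    fix r s assume "r \<in> {..<Suc a}" "s \<in> {..<Suc a}" "r < s"
    then show "shift \<tau> r < shift \<tau> s"
      using strict_mono_onD[OF *(2), of "r - 1" "s - 1"] by (cases r; cases s) auto
  qed
  moreover have "strict_mono_on {Suc a..<Suc a + Suc b} (shift \<tau>)"
  proof (rule strict_mono_onI)
    fix r s assume "r \<in> {Suc a..<Suc a + Suc b}" "s \<in> {Suc a..<Suc a + Suc b}" "r < s"
    then show "shift \<tau> r < shift \<tau> s"
      using strict_mono_onD[OF *(3), of "r - 1" "s - 1"] by (cases r; cases s) auto
  qed
  ultimately show ?thesis
    using *(1) permutes_shift_iff[of \<tau> "a + Suc b"] by (simp add: unshuffles_def)
qed

lemma shift_cyc_unshuffles:
  assumes "\<tau> \<in> unshuffles (Suc a) b"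
  shows "shift \<tau> \<circ> cyc (Suc a) \<in> unshuffles (Suc a) (Suc b)"
proof -
  let ?s = "shift \<tau> \<circ> cyc (Suc a)"
  have *: "\<tau> permutes {..<Suc a + b}" "strict_mono_on {..<Suc a} \<tau>"
    "strict_mono_on {Suc a..<Suc a + b} \<tau>"
    using assms by (auto simp: unshuffles_def)
  have "strict_mono_on {..<Suc a} ?s"
    using strict_mono_onD[OF *(2)] by (auto intro!: strict_mono_onI simp: cyc_def)
  moreover have "strict_mono_on {Suc a..<Suc a + Suc b} ?s"
  proof (rule strict_mono_onI)
    fix r s assume "r \<in> {Suc a..<Suc a + Suc b}" "s \<in> {Suc a..<Suc a + Suc b}" "r < s"
    then show "?s r < ?s s"
      using strict_mono_onD[OF *(3), of "r - 1" "s - 1"] by (cases r; cases s) (auto simp: cyc_def)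
  qed
  moreover have "?s permutes {..<Suc a + Suc b}"
    using *(1) permutes_shift_iff[of \<tau> "Suc a + b"] permutes_cyc[of "Suc a" "Suc a + Suc b"]
    by (intro permutes_compose) auto
  ultimately show ?thesis
    by (simp add: unshuffles_def)
qed

lemma unshuffles_first:
  assumes \<sigma>: "\<sigma> \<in> unshuffles (Suc a) (Suc b)" and "\<sigma> 0 = 0"
  shows "\<exists>\<tau> \<in> unshuffles a (Suc b). \<sigma> = shift \<tau>"
proof
  have *: "\<sigma> permutes {..<Suc (a + Suc b)}" "strict_mono_on {..<Suc a} \<sigma>"
    "strict_mono_on {Suc a..<Suc a + Suc b} \<sigma>"
    using \<sigma> by (auto simp: unshuffles_def)
  define \<tau> where "\<tau> = (\<lambda>i. \<sigma> (Suc i) - 1)"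
  have pos: "\<sigma> (Suc i) > 0" for i
    using permutes_inj[OF *(1), THEN injD, of "Suc i" 0] assms(2) by fastforce
  have S: "\<sigma> (Suc i) = Suc (\<tau> i)" for i
    using pos[of i] by (simp add: \<tau>_def)
  show eq: "\<sigma> = shift \<tau>"
    by (rule ext, rename_tac i, case_tac i) (simp_all add: S assms(2))
  have "strict_mono_on {..<a} \<tau>"
    using strict_mono_onD[OF *(2), of "Suc _" "Suc _"] by (auto intro!: strict_mono_onI simp: S)
  moreover have "strict_mono_on {a..<a + Suc b} \<tau>"
    using strict_mono_onD[OF *(3), of "Suc _" "Suc _"] by (auto intro!: strict_mono_onI simp: S)
  ultimately show "\<tau> \<in> unshuffles a (Suc b)"
    using *(1) unfolding eq permutes_shift_iff by (simp add: unshuffles_def)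
qed

lemma unshuffles_second:
  assumes \<sigma>: "\<sigma> \<in> unshuffles (Suc a) (Suc b)" and "\<sigma> (Suc a) = 0"
  shows "\<exists>\<tau> \<in> unshuffles (Suc a) b. \<sigma> = shift \<tau> \<circ> cyc (Suc a)"
proof
  have *: "\<sigma> permutes {..<Suc (Suc a + b)}" "strict_mono_on {..<Suc a} \<sigma>"
    "strict_mono_on {Suc a..<Suc a + Suc b} \<sigma>"
    using \<sigma> by (auto simp: unshuffles_def)
  \<comment> \<open>Deletes position \<open>Suc a\<close>, where the value 0 sits, and lowers the
    remaining values by 1.\<close>
  define \<tau> where "\<tau> = (\<lambda>i. \<sigma> (if i < Suc a then i else Suc i) - 1)"
  have pos: "\<sigma> i > 0" if "i \<noteq> Suc a" for i
    using permutes_inj[OF *(1), THEN injD, of "Suc a" i] assms(2) that by fastforce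
  have S1: "\<sigma> i = Suc (\<tau> i)" if "i < Suc a" for i
    using pos[of i] that by (simp add: \<tau>_def)
  have S2: "\<sigma> (Suc i) = Suc (\<tau> i)" if "i \<ge> Suc a" for i
    using pos[of "Suc i"] that by (simp add: \<tau>_def)
  have "\<sigma> i = (shift \<tau> \<circ> cyc (Suc a)) i" for i
  proof (cases "i \<le> Suc a")
    case True
    then show ?thesis using S1[of i] assms(2) by (auto simp: cyc_def)
  next
    case False
    then show ?thesis using S2[of "i - 1"] by (cases i) (auto simp: cyc_def)
  qed
  then show eq: "\<sigma> = shift \<tau> \<circ> cyc (Suc a)" by blast
  have cyc: "cyc (Suc a) permutes {..<Suc (Suc a + b)}"
    by (rule permutes_cyc) simp
  have "shift \<tau> = \<sigma> \<circ> inv (cyc (Suc a))"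
    unfolding eq comp_assoc using permutes_inv_o(1)[OF cyc] by simp
  then have "\<tau> permutes {..<Suc a + b}"
    using permutes_compose[OF permutes_inv[OF cyc] *(1)] permutes_shift_iff by metis
  moreover have "strict_mono_on {..<Suc a} \<tau>"
    using strict_mono_onD[OF *(2)] by (auto intro!: strict_mono_onI simp: S1)
  moreover have "strict_mono_on {Suc a..<Suc a + b} \<tau>"
  proof (rule strict_mono_onI)
    fix r s assume "r \<in> {Suc a..<Suc a + b}" "s \<in> {Suc a..<Suc a + b}" "r < s"
    then show "\<tau> r < \<tau> s"
      using strict_mono_onD[OF *(3), of "Suc r" "Suc s"] by (simp add: S2)
  qed
  ultimately show "\<tau> \<in> unshuffles (Suc a) b"
    by (simp add: unshuffles_def)
qed

lemma unshuffles_zero_cases: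
  assumes \<sigma>: "\<sigma> \<in> unshuffles (Suc a) (Suc b)"
  shows "\<sigma> 0 = 0 \<or> \<sigma> (Suc a) = 0"
proof -
  have *: "\<sigma> permutes {..<Suc (Suc a + b)}" "strict_mono_on {..<Suc a} \<sigma>"
    "strict_mono_on {Suc a..<Suc a + Suc b} \<sigma>"
    using \<sigma> by (auto simp: unshuffles_def)
  obtain k where k: "\<sigma> k = 0"
    using permutes_surj[OF *(1)] by (metis surjD)
  have "k < Suc (Suc a + b)"
    using permutes_not_in[OF *(1), of k] k by (cases "k < Suc (Suc a + b)") auto
  then show ?thesis
    using strict_mono_onD[OF *(2), of 0 k] strict_mono_onD[OF *(3), of "Suc a" k] k
    by (cases "k = 0"; cases "k = Suc a"; cases "k < Suc a") auto
qed

text \<open>Blocks increase, so the value 0 can only head one of them; deleting it shortens that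
  block.\<close>

lemma unshuffles_Suc_Suc:
  "unshuffles (Suc a) (Suc b) =
    shift ` unshuffles a (Suc b) \<union> (\<lambda>\<tau>. shift \<tau> \<circ> cyc (Suc a)) ` unshuffles (Suc a) b"
  using unshuffles_zero_cases unshuffles_first unshuffles_second
    shift_unshuffles shift_cyc_unshuffles by (fastforce simp del: comp_apply)

lemma inj_shift: "inj shift"
  by (rule injI) (metis ext nat.inject shift_simps(2))

lemma inj_shift_cyc: "inj (\<lambda>\<tau>. shift \<tau> \<circ> cyc m)"
proof (rule injI)
  fix \<tau> \<tau>' assume "shift \<tau> \<circ> cyc m = shift \<tau>' \<circ> cyc m"
  moreover have "surj (cyc m)"
    using permutes_surj[OF permutes_cyc[of m "Suc m"]] by simp
  ultimately have "shift \<tau> = shift \<tau>'"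
    by (metis comp_apply ext surjD)
  then show "\<tau> = \<tau>'" by (rule injD[OF inj_shift])
qed

lemma shift_shift_cyc_neq: "shift \<tau> \<noteq> shift \<tau>' \<circ> cyc (Suc m)"
proof
  assume "shift \<tau> = shift \<tau>' \<circ> cyc (Suc m)"
  from fun_cong[OF this, of "Suc m"] show False by (simp add: cyc_def)
qed

text \<open>Settles the case of an empty block: an increasing map lies above the identity, and a
  permutation doing so is the identity.\<close>

lemma strict_mono_permutes_id:
  fixes n :: nat
  assumes "\<sigma> permutes {..<n}" "strict_mono_on {..<n} \<sigma>"
  shows "\<sigma> = id"
proof -
  have "i < n \<Longrightarrow> i \<le> \<sigma> i" for i
  proof (induction i)
    case (Suc i)
    then show ?case using strict_mono_onD[OF assms(2), of i "Suc i"] by force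
  qed simp
  then show ?thesis by (intro permutes_natset_ge[OF assms(1)]) simp
qed

lemma unshuffles_0 [simp]: "unshuffles 0 b = {id}" "unshuffles a 0 = {id}"
  by (auto simp: unshuffles_def permutes_id strict_mono_on_def intro: strict_mono_permutes_id)

subsection \<open>Nijenhuis-Richardson brackets with binary and unary maps\<close>

context vector_space_char_0
begin

abbreviation shuf :: "nat \<Rightarrow> nat \<Rightarrow> 'v form \<Rightarrow> 'v form \<Rightarrow> 'v form"
  where "shuf \<equiv> shuffle_comp scale"

lemma shuf_0:
  "shuf 0 b f g x = f (case_nat (g x) x)"
  "shuf a 0 f g x = f (case_nat (g x) (\<lambda>i. x (a + i)))"
  by (simp_all add: shuffle_comp_def)

text \<open>The argument \<open>v\<close> either goes into \<open>g\<close> or follows the value of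
  \<open>g\<close> in \<open>f\<close>. The latter moves it past the \<open>Suc a\<close> arguments
  of \<open>g\<close>, whence the sign, and puts it into the second slot of
  \<open>f\<close>.\<close>

lemma shuf_Suc_Suc:
  assumes dep: "\<And>x y. (\<forall>i<Suc a. x i = y i) \<Longrightarrow> g x = g y"
  shows "ctr v (shuf (Suc a) (Suc b) f g) =
    shuf a (Suc b) f (ctr v g) +
    sform ((- 1) ^ Suc a) (shuf (Suc a) b (\<lambda>z. ctr v (ctr (z 0) f) (z \<circ> Suc)) g)"
proof
  fix y :: "nat \<Rightarrow> 'v"
  let ?x = "case_nat v y"
  let ?t = "\<lambda>\<sigma>. scale (of_int (sign \<sigma>))
    (f (case_nat (g (\<lambda>i. ?x (\<sigma> i))) (\<lambda>i. ?x (\<sigma> (Suc a + i)))))"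
  have 1: "?t (shift \<tau>) = scale (of_int (sign \<tau>))
      (f (case_nat (ctr v g (\<lambda>i. y (\<tau> i))) (\<lambda>i. y (\<tau> (a + i)))))"
    if "\<tau> \<in> unshuffles a (Suc b)" for \<tau>
  proof -
    have "(\<lambda>i. ?x (shift \<tau> i)) = case_nat v (\<lambda>i. y (\<tau> i))"
      by (auto simp: fun_eq_iff split: nat.split)
    then show ?thesis
      by (simp add: ctr_def sign_shift[OF unshuffles_permutes[OF that]])
  qed
  have 2: "?t (shift \<tau> \<circ> cyc (Suc a)) = scale ((- 1) ^ Suc a) (scale (of_int (sign \<tau>))
      (ctr v (ctr (g (\<lambda>i. y (\<tau> i))) f) (\<lambda>i. y (\<tau> (Suc a + i)))))"
    if "\<tau> \<in> unshuffles (Suc a) b" for \<tau>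
  proof -
    note \<tau> = unshuffles_permutes[OF that]
    have "permutation (shift \<tau>)" "permutation (cyc (Suc a))"
      using \<tau> permutes_shift_iff permutes_cyc[of "Suc a" "Suc (Suc a)"]
      by (auto simp: permutation_permutes)
    then have s: "sign (shift \<tau> \<circ> cyc (Suc a)) = (- 1) ^ Suc a * sign \<tau>"
      by (simp add: sign_compose sign_shift[OF \<tau>] sign_cyc)
    \<comment> \<open>The two sequences agree only below \<open>Suc a\<close>, where the left one
      takes the value \<open>v\<close>; hence the appeal to \<open>dep\<close>.\<close>
    have g: "g (\<lambda>i. ?x ((shift \<tau> \<circ> cyc (Suc a)) i)) = g (\<lambda>i. y (\<tau> i))"
      by (rule dep) (simp add: cyc_def)
    have r: "(\<lambda>i. ?x ((shift \<tau> \<circ> cyc (Suc a)) (Suc a + i))) =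
        case_nat v (\<lambda>i. y (\<tau> (Suc a + i)))"
      by (auto simp: fun_eq_iff cyc_def split: nat.split)
    show ?thesis
      unfolding s g r by (simp add: ctr_def)
  qed
  have "ctr v (shuf (Suc a) (Suc b) f g) y = sum ?t (unshuffles (Suc a) (Suc b))"
    by (simp add: ctr_def shuffle_comp_def)
  also have "\<dots> = sum ?t (shift ` unshuffles a (Suc b)) +
      sum ?t ((\<lambda>\<tau>. shift \<tau> \<circ> cyc (Suc a)) ` unshuffles (Suc a) b)"
    unfolding unshuffles_Suc_Suc
    by (rule sum.union_disjoint) (use shift_shift_cyc_neq finite_unshuffles in blast)+
  also have "\<dots> = (\<Sum>\<tau>\<in>unshuffles a (Suc b). ?t (shift \<tau>)) +
      (\<Sum>\<tau>\<in>unshuffles (Suc a) b. ?t (shift \<tau> \<circ> cyc (Suc a)))"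
    using sum.reindex[OF inj_on_subset[OF inj_shift subset_UNIV], of ?t]
      sum.reindex[OF inj_on_subset[OF inj_shift_cyc subset_UNIV], of ?t]
    unfolding comp_apply by simp
  also have "\<dots> = (shuf a (Suc b) f (ctr v g) +
    sform ((- 1) ^ Suc a) (shuf (Suc a) b (\<lambda>z. ctr v (ctr (z 0) f) (z \<circ> Suc)) g)) y"
    by (simp only: 1 2 cong: sum.cong)
      (simp add: pointwise shuffle_comp_def scale_form_def scale_sum_right comp_def)
  finally show "ctr v (shuf (Suc a) (Suc b) f g) y = \<dots>" .
qed

lemma shuf_uminus: "shuf a b (- f) g = - shuf a b f g"
  by (simp add: fun_eq_iff shuffle_comp_def pointwise sum_negf)

section \<open>Agreement of \<open>alt\<close> with \<open>Hom_wedge\<close>\<close>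

lemma alt_depends:
  "alt n f \<Longrightarrow> (\<forall>i<n. x i = y i) \<Longrightarrow> f x = f y"
proof (induction n arbitrary: f x y)
  case (Suc n)
  then have "x 0 = y 0" by simp
  moreover have "ctr (x 0) f (x \<circ> Suc) = ctr (x 0) f (y \<circ> Suc)"
    by (rule Suc.IH) (use Suc.prems in auto)
  ultimately show ?case by (metis ctr_apply)
qed auto

lemma Hom_wedge_alt: "f \<in> Hom_wedge scale n \<Longrightarrow> alt n f"
proof (induction n arbitrary: f)
  case 0
  then show ?case by (auto simp: Hom_wedge_def)
next
  case (Suc n)
  have dep: "f x = f y" if "\<And>i. i < Suc n \<Longrightarrow> x i = y i" for x y
    using Suc.prems that by (simp add: Hom_wedge_def)
  have lin: "lin (\<lambda>v. f (x(i := v)))" if "i < Suc n" for x i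
    using Suc.prems that by (simp add: Hom_wedge_def)
  have z: "f x = 0" if "i < j" "j < Suc n" "x i = x j" for x i j
    using Suc.prems that unfolding Hom_wedge_def by blast
  have upd: "(case_nat v x)(Suc i := u) = case_nat v (x(i := u))" for v u :: 'v and x i
    by (auto simp: fun_eq_iff split: nat.split)
  have upd0: "(case_nat v x)(0 := u) = case_nat u x" for v u :: 'v and x
    by (auto simp: fun_eq_iff split: nat.split)
  have "alt n (ctr v f)" for v
  proof (rule Suc.IH)
    have "ctr v f x = ctr v f y" if "\<forall>i<n. x i = y i" for x y
      unfolding ctr_def using that by (intro dep) (auto split: nat.split)
    moreover have "lin (\<lambda>u. ctr v f (x(i := u)))" if "i < n" for x i
      using lin[of "Suc i" "case_nat v x"] that by (simp add: ctr_def upd)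
    moreover have "ctr v f x = 0" if "i < j" "j < n" "x i = x j" for x i j
      unfolding ctr_def using that by (intro z[of "Suc i" "Suc j"]) auto
    ultimately show "ctr v f \<in> Hom_wedge scale n"
      unfolding Hom_wedge_def by blast
  qed
  \<comment> \<open>The head 0 in \<open>case_nat 0 _\<close> is a placeholder that the update at
    position 0 overwrites.\<close>
  moreover have "ctr (u + v) f = ctr u f + ctr v f" for u v
    using linD(1)[OF lin[of 0 "case_nat 0 _"]] by (simp add: ctr_def fun_eq_iff upd0 pointwise)
  moreover have "ctr (scale a v) f = sform a (ctr v f)" for a v
    using linD(2)[OF lin[of 0 "case_nat 0 _"]] by (simp add: ctr_def fun_eq_iff upd0 scale_form_def)
  moreover have "ctr v (ctr v f) = 0" if "n > 0" for v
    using that by (auto simp: ctr_def fun_eq_iff pointwise intro!: z[of 0 1])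
  ultimately show ?case by simp
qed

lemma alt_Hom_wedge: "alt n f \<Longrightarrow> f \<in> Hom_wedge scale n"
proof -
  have lin: "lin (\<lambda>v. f (x(i := v)))" if "alt n f" "i < n" for x i
    using that
  proof (induction n arbitrary: f x i)
    case (Suc n)
    note f = ctr_alt[OF Suc.prems(1)]
    show ?case
    proof (cases i)
      case 0
      have "f (x(i := v)) = ctr v f (x \<circ> Suc)" for v
        using ctr_apply[of "x(i := v)" f] 0 by (simp add: comp_def)
      then show ?thesis
        by (simp add: lin_iff f pointwise scale_form_def del: fun_upd_apply)
    next
      case (Suc j)
      have "f (x(i := v)) = ctr (x 0) f ((x \<circ> Suc)(j := v))" for v
        using ctr_apply[of "x(i := v)" f] Suc by (simp add: comp_def fun_upd_def)
      then show ?thesis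
        using Suc.IH[OF f(1), of j "x 0" "x \<circ> Suc"] Suc.prems(2) Suc by (simp del: fun_upd_apply comp_apply)
    qed
  qed simp
  have z: "f x = 0" if "alt n f" "i < j" "j < n" "x i = x j" for x i j
    using that
  proof (induction n arbitrary: f x i j)
    case (Suc n)
    note f = ctr_alt[OF Suc.prems(1)]
    obtain k where j: "j = Suc k" using Suc.prems by (cases j) auto
    obtain m where n: "n = Suc m" using Suc.prems j by (cases n) auto
    have f2: "f x = ctr (x 1) (ctr (x 0) f) (x \<circ> Suc \<circ> Suc)" for x
      by (metis ctr_apply comp_apply One_nat_def)
    show ?case
    proof (cases i)
      case i: 0
      show ?thesis
      proof (cases k)
        case 0
        then show ?thesis
          using f2[of x] f(4)[of "x 0"] n Suc.prems i j by (simp add: pointwise)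
      next
        case (Suc l)
        \<comment> \<open>Swapping the first two arguments keeps \<open>x 0\<close> among the
          arguments of \<open>ctr (x 1) f\<close>, where it meets its repetition and induction
          applies.\<close>
        have "f x = - ctr (x 0) (ctr (x 1) f) (x \<circ> Suc \<circ> Suc)"
          using f2[of x] ctr_swap[of m f "x 1" "x 0"] Suc.prems(1) n by (simp add: pointwise)
        also have "\<dots> = - ctr (x 1) f (case_nat (x 0) (x \<circ> Suc \<circ> Suc))"
          by (simp add: ctr_def)
        also have "ctr (x 1) f (case_nat (x 0) (x \<circ> Suc \<circ> Suc)) = 0"
          by (rule Suc.IH[OF f(1), of 0 k]) (use Suc Suc.prems i j in auto)
        finally show ?thesis by simp
      qed
    next
      case i: (Suc l)
      have "ctr (x 0) f (x \<circ> Suc) = 0"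
        by (rule Suc.IH[OF f(1), of l k]) (use Suc.prems i j in auto)
      then show ?thesis by (simp add: ctr_apply)
    qed
  qed simp
  show "alt n f \<Longrightarrow> f \<in> Hom_wedge scale n"
    unfolding Hom_wedge_def using lin z alt_depends by blast
qed

lemma Hom_wedge_iff: "f \<in> Hom_wedge scale n \<longleftrightarrow> alt n f"
  using Hom_wedge_alt alt_Hom_wedge by blast

text \<open>Brings the second term of \<open>shuf_Suc_Suc\<close> back to a contraction.\<close>

lemma swap_head: "alt (Suc (Suc n)) f \<Longrightarrow> (\<lambda>z. ctr v (ctr (z 0) f) (z \<circ> Suc)) = - ctr v f"
  by (rule ext) (metis ctr_swap uminus_apply ctr_apply)

text \<open>One half of \<open>[f, \<delta>]\<close>; the summand added to \<open>Lie\<close> is the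
  other half, which \<open>Lie\<close> subtracts at arity 0.\<close>

lemma shuf_form1:
  assumes "lin \<delta>"
  shows "alt (Suc q) f \<Longrightarrow> shuf 1 q f (form1 \<delta>) = Lie (Suc q) \<delta> f + (\<lambda>x. \<delta> (f x))"
proof (induction q arbitrary: f)
  case 0
  have "f (case_nat (\<delta> (x 0)) (\<lambda>i. x (Suc i))) = Lie 1 \<delta> f x + \<delta> (f x)" for x
    using ctr_apply[of x f] by (simp add: Lie.simps(2) ctr_def comp_def)
  then show ?case
    by (simp add: fun_eq_iff shuf_0 form1_def pointwise)
next
  case (Suc q)
  note f = Suc.prems
  have "ctr v (shuf 1 (Suc q) f (form1 \<delta>)) = ctr v (Lie (Suc (Suc q)) \<delta> f + (\<lambda>x. \<delta> (f x)))" for v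
  proof -
    have 1: "shuf 0 (Suc q) f (ctr v (form1 \<delta>)) = ctr (\<delta> v) f"
      by (simp add: shuf_0 ctr_def form1_def fun_eq_iff)
    \<comment> \<open>The sign of \<open>shuf_Suc_Suc\<close> cancels the one of
      \<open>swap_head\<close>.\<close>
    have "ctr v (shuf 1 (Suc q) f (form1 \<delta>)) = ctr (\<delta> v) f + shuf 1 q (ctr v f) (form1 \<delta>)"
      using shuf_Suc_Suc[of 0 "form1 \<delta>" v q f]
      by (simp add: 1 swap_head[OF f] shuf_uminus uminus_sform[symmetric] form1_def)
    then show ?thesis
      unfolding Suc.IH[OF ctr_alt(1)[OF f]] by (simp add: ctr_Lie) (simp add: ctr_def)
  qed
  then show ?case by (rule form_eqI)
qed

lemma NR_form1:
  assumes "lin \<delta>" "alt (Suc q) f"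
  shows "NR_bracket scale q 0 f (form1 \<delta>) = Lie (Suc q) \<delta> f"
proof -
  have "shuf (Suc q) 0 (form1 \<delta>) f = (\<lambda>x. \<delta> (f x))"
    by (simp add: fun_eq_iff shuf_0 form1_def)
  then show ?thesis
    using shuf_form1[OF assms] by (simp add: NR_bracket_def NR_comp_eq sform_simps)
qed

end

context lie_algebra
begin

text \<open>Both sides obey the same recursion under contraction, by \<open>shuf_Suc_Suc\<close> and
  \<open>ctr_CE\<close>; linear maps are the base.\<close>

lemma NR_form2:
  "alt (Suc q) f \<Longrightarrow> NR_bracket scale 1 q (form2 br) f = sform ((- 1) ^ Suc q) (d (Suc q) f)"
proof (induction q arbitrary: f)
  case 0
  \<comment> \<open>The linear map underlying the form \<open>f\<close> of arity 1.\<close>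
  define c where "c v = ctr v f undefined" for v
  have c: "ctr v f = (\<lambda>_. c v)" for v
    using ctr_alt(1)[OF 0, of v] unfolding c_def by (simp add: fun_eq_iff)
  have fc: "f x = c (x 0)" for x
    by (metis c ctr_apply)
  show ?case
  proof (rule form_eqI)
    fix v
    have "ctr v (ctr a (form2 br)) = (\<lambda>_. br a v)" for a
      by (simp add: ctr_def form2_def)
    then have 1: "ctr v (shuf 1 1 (form2 br) f) = (\<lambda>y. br (c v) (y 0) - br (c (y 0)) v)"
      using shuf_Suc_Suc[of 0 f v 0 "form2 br"] fc
      by (simp add: shuf_0 fun_eq_iff pointwise scale_form_def form2_def c)
    have 2: "ctr v (shuf 2 0 f (form2 br)) = (\<lambda>y. c (br v (y 0)))"
      by (simp add: ctr_def shuf_0 form2_def fun_eq_iff fc)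
    have 3: "ctr v (d (Suc 0) f) = (\<lambda>y. c (br v (y 0)) - br v (c (y 0)) - br (c v) (y 0))"
      by (simp add: ctr_CE Lie.simps(2) fun_eq_iff pointwise c)
    show "ctr v (NR_bracket scale 1 0 (form2 br) f) = ctr v (sform ((- 1) ^ Suc 0) (d (Suc 0) f))"
      using 1 2 3 br_swap[of v]
      by (simp add: NR_bracket_def NR_comp_eq sform_simps numeral_2_eq_2)
        (simp add: fun_eq_iff pointwise scale_form_def)
  qed
next
  case (Suc q)
  note f = Suc.prems
  show ?case
  proof (rule form_eqI)
    fix v
    \<comment> \<open>The term that both halves of the bracket contribute, with opposite
      signs.\<close>
    define P where "P = (\<lambda>y. br v (f y))"
    have dep: "\<forall>i<Suc (Suc q). x i = y i \<Longrightarrow> f x = f y" for x y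
      by (rule alt_depends[OF f])
    have "ctr v (ctr a (form2 br)) = (\<lambda>_. - br v a)" for a
      by (simp add: ctr_def form2_def br_swap[of a v])
    then have "shuf (Suc (Suc q)) 0 (\<lambda>z. ctr v (ctr (z 0) (form2 br)) (z \<circ> Suc)) f = - P"
      by (simp add: shuf_0 fun_eq_iff pointwise P_def)
    then have 1: "ctr v (shuf (Suc (Suc q)) 1 (form2 br) f) =
        shuf (Suc q) 1 (form2 br) (ctr v f) - sform ((- 1) ^ q) P"
      using shuf_Suc_Suc[of "Suc q" f v 0 "form2 br", OF dep] by (simp add: sform_simps)
    have "ctr v (form2 br) = form1 (br v)"
      by (simp add: ctr_def form2_def form1_def fun_eq_iff)
    then have 2: "ctr v (shuf 2 (Suc q) f (form2 br)) =
        Lie (Suc (Suc q)) (br v) f + P - shuf 2 q (ctr v f) (form2 br)"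
      using shuf_Suc_Suc[of 1 "form2 br" v q f] shuf_form1[OF lin_br(1)[of v] f]
      by (simp add: swap_head[OF f] shuf_uminus sform_simps form2_def numeral_2_eq_2 P_def)
    \<comment> \<open>The induction hypothesis is solved for one half of the bracket, so that the
      other half cancels against its occurrence in \<open>2\<close>.\<close>
    have "NR_bracket scale 1 q (form2 br) (ctr v f) = - sform ((- 1) ^ q) (d (Suc q) (ctr v f))"
      unfolding Suc.IH[OF ctr_alt(1)[OF f]] by (simp add: fun_eq_iff scale_form_def pointwise)
    then have 3: "shuf (Suc q) 1 (form2 br) (ctr v f) =
        sform ((- 1) ^ q) (shuf 2 q (ctr v f) (form2 br)) - sform ((- 1) ^ q) (d (Suc q) (ctr v f))"
      by (simp add: NR_bracket_def NR_comp_eq numeral_2_eq_2 algebra_simps)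
    have neg: "sform (- a) g = - sform a g" for a g
      by (simp add: fun_eq_iff scale_form_def pointwise)
    have 4: "NR_bracket scale 1 (Suc q) (form2 br) f =
        shuf (Suc (Suc q)) 1 (form2 br) f + sform ((- 1) ^ q) (shuf 2 (Suc q) f (form2 br))"
      by (simp add: NR_bracket_def NR_comp_eq numeral_2_eq_2 neg)
    show "ctr v (NR_bracket scale 1 (Suc q) (form2 br) f) =
        ctr v (sform ((- 1) ^ Suc (Suc q)) (d (Suc (Suc q)) f))"
      unfolding 4 ctr_add ctr_scale_form ctr_CE 1 2 3 by (simp add: sform_simps)
  qed
qed

end

subsection \<open>The coboundary operator\<close>

context vector_space_char_0
begin

lemma CE_add_left:
  "alt n f \<Longrightarrow> CE (\<lambda>x y. w x y + w' x y) n f = CE w n f + CE w' n f"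
proof (induction n arbitrary: f)
  case 0
  then show ?case by (simp add: fun_eq_iff pointwise)
next
  case (Suc n)
  show ?case
    by (rule form_eqI)
      (simp add: ctr_CE Suc.IH[OF ctr_alt(1)[OF Suc.prems]] Lie_add_left[OF Suc.prems])
qed

text \<open>
  The contribution of one LieDer pair to the coboundary of one entry of a cochain of
  degree \<open>Suc m\<close>, with the global sign \<open>(- 1) ^ m\<close> multiplied out.
\<close>

definition layer :: "('v \<Rightarrow> 'v \<Rightarrow> 'v) \<Rightarrow> ('v \<Rightarrow> 'v) \<Rightarrow> nat \<Rightarrow>
    'v form \<times> 'v form \<Rightarrow> 'v form \<times> 'v form"
  where "layer w \<delta> m c =
    (- CE w (Suc m) (fst c),
     - CE w m (snd c) - sform ((- 1) ^ m) (Lie (Suc m) \<delta> (fst c)))"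

text \<open>For \<open>m = 0\<close> the second component may be any constant, whereas
  \<open>C_LieDer\<close> demands 0 there; so membership in \<open>C_LieDer\<close> is recovered
  from degree 2 on.\<close>

definition cochain :: "nat \<Rightarrow> 'v form \<times> 'v form \<Rightarrow> bool"
  where "cochain m c \<longleftrightarrow> alt (Suc m) (fst c) \<and> alt m (snd c)"

lemma cochain_0 [simp]: "cochain m 0"
  by (simp add: cochain_def del: alt.simps)

lemma cochain_add: "cochain m c \<Longrightarrow> cochain m c' \<Longrightarrow> cochain m (c + c')"
  by (simp add: cochain_def alt_add del: alt.simps)

lemma C_LieDer_cochain: "c \<in> C_LieDer scale (Suc m) \<Longrightarrow> cochain m c"
  by (cases c) (auto simp: C_LieDer_def cochain_def Hom_wedge_iff simp del: alt.simps split: if_splits)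

lemma cochain_C_LieDer: "cochain (Suc m) c \<Longrightarrow> c \<in> C_LieDer scale (Suc (Suc m))"
  by (cases c) (auto simp: C_LieDer_def cochain_def Hom_wedge_iff simp del: alt.simps)

lemma layer_add_left:
  "cochain m c \<Longrightarrow>
    layer (\<lambda>x y. w x y + w' x y) (\<lambda>x. \<delta> x + \<delta>' x) m c = layer w \<delta> m c + layer w' \<delta>' m c"
  by (simp add: layer_def cochain_def CE_add_left Lie_add_left sform_simps algebra_simps del: alt.simps)

end

context LieDer_pair
begin

abbreviation T :: "nat \<Rightarrow> 'v form \<times> 'v form \<Rightarrow> 'v form \<times> 'v form"
  where "T \<equiv> layer br \<delta>"

lemma T_add: "T m (c + c') = T m c + T m c'"
  by (simp add: layer_def d_add Lie_add[OF linear_derivation] sform_simps)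

lemma T_0 [simp]: "T m 0 = 0"
  using T_add[of m 0 0] by simp

lemma cochain_T: "cochain m c \<Longrightarrow> cochain (Suc m) (T m c)"
  by (simp add: cochain_def layer_def alt_uminus alt_diff alt_sform alt_d
      alt_Lie[OF linear_derivation] del: alt.simps)

text \<open>In the second component \<open>d\<close> after \<open>Lie\<close> and \<open>Lie\<close>
  after \<open>d\<close> occur with opposite signs, as the sign of \<open>layer\<close> alternates,
  and \<open>Lie_d\<close> identifies them.\<close>

lemma T_T: "cochain m c \<Longrightarrow> T (Suc m) (T m c) = 0"
  by (simp add: layer_def cochain_def d_d d_diff d_uminus d_sform Lie_d
      Lie_uminus[OF linear_derivation] sform_simps zero_prod_def del: alt.simps)
    (simp add: fun_eq_iff scale_form_def pointwise)

text \<open>The signs from \<open>NR_form2\<close> absorb the global sign, leaving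
  \<open>- d\<close> in every degree. Degree 1 is separate for the second component, which has no
  bracket with \<open>g\<close>.\<close>

lemma T_NR:
  assumes "cochain m (f, g)"
  shows "fst (T m (f, g)) = sform ((- 1) ^ m) (NR_bracket scale 1 m (form2 br) f)"
    and "m > 0 \<Longrightarrow> snd (T m (f, g)) = sform ((- 1) ^ m)
      (- NR_bracket scale 1 (m - 1) (form2 br) g - NR_bracket scale m 0 f (form1 \<delta>))"
    and "m = 0 \<Longrightarrow> snd (T m (f, 0)) = - NR_bracket scale m 0 f (form1 \<delta>)"
proof -
  have neg: "sform (- 1) f = - f" for f
    by (rule uminus_sform[symmetric])
  have f: "alt (Suc m) f" and g: "alt m g"
    using assms by (simp_all add: cochain_def)
  show "fst (T m (f, g)) = sform ((- 1) ^ m) (NR_bracket scale 1 m (form2 br) f)"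
    unfolding NR_form2[OF f] by (simp add: layer_def sform_simps power_add[symmetric] neg)
  show "snd (T m (f, g)) = sform ((- 1) ^ m)
      (- NR_bracket scale 1 (m - 1) (form2 br) g - NR_bracket scale m 0 f (form1 \<delta>))" if "m > 0"
  proof -
    obtain k where m: "m = Suc k" using \<open>m > 0\<close> gr0_implies_Suc by blast
    show ?thesis
      using NR_form2[OF g[unfolded m]] NR_form1[OF linear_derivation f]
      by (simp add: m layer_def sform_simps power_add[symmetric] neg)
  qed
  show "snd (T m (f, 0)) = - NR_bracket scale m 0 f (form1 \<delta>)" if "m = 0"
    using NR_form1[OF linear_derivation f] that by (simp add: layer_def sform_simps del: CE.simps)
qed

end

section \<open>Polarisation and the coboundary on tuples\<close>

context compatible_LieDer_pair
begin

text \<open>The two compatibility conditions are the cross terms of Jacobi and Leibniz for the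
  sum.\<close>

lemma LieDer_pair_sum:
  "LieDer_pair scale (\<lambda>x y. br1 x y + br2 x y) (\<lambda>x. \<delta>1 x + \<delta>2 x)"
proof unfold_locales
  show "cyclic_sum (\<lambda>x y z. br1 x (br1 y z + br2 y z) + br2 x (br1 y z + br2 y z)) x y z = 0" for x y z
  proof -
    have "cyclic_sum (\<lambda>x y z. br1 x (br1 y z + br2 y z) + br2 x (br1 y z + br2 y z)) x y z =
        cyclic_sum (\<lambda>x y z. br1 x (br1 y z)) x y z + cyclic_sum (\<lambda>x y z. br2 x (br2 y z)) x y z +
        (cyclic_sum (\<lambda>x y z. br2 x (br1 y z)) x y z + cyclic_sum (\<lambda>x y z. br1 x (br2 y z)) x y z)"
      by (simp only: cyclic_sum_def p1.br_simps p2.br_simps) (simp add: algebra_simps)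
    then show ?thesis
      by (simp only: p1.jacobi p2.jacobi compatible_brackets add_0)
  qed
  show "\<delta>1 (br1 x y + br2 x y) + \<delta>2 (br1 x y + br2 x y) =
      br1 (\<delta>1 x + \<delta>2 x) y + br2 (\<delta>1 x + \<delta>2 x) y + (br1 x (\<delta>1 y + \<delta>2 y) + br2 x (\<delta>1 y + \<delta>2 y))"
    for x y
  proof -
    have "\<delta>1 (br1 x y + br2 x y) + \<delta>2 (br1 x y + br2 x y) =
        \<delta>1 (br1 x y) + \<delta>2 (br2 x y) + (\<delta>1 (br2 x y) + \<delta>2 (br1 x y))"
      by (simp add: p1.linD[OF p1.linear_derivation] p1.linD[OF p2.linear_derivation] algebra_simps)
    then show ?thesis
      unfolding compatible_derivations p1.leibniz p2.leibniz
      by (simp add: p1.br_simps p2.br_simps algebra_simps)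
  qed
qed (simp_all add: p1.lin_iff p1.br_simps p2.br_simps p1.bracket_self p2.bracket_self
    p1.linD[OF p1.linear_derivation] p1.linD[OF p2.linear_derivation] p1.scale_right_distrib algebra_simps)

sublocale p12: LieDer_pair scale "\<lambda>x y. br1 x y + br2 x y" "\<lambda>x. \<delta>1 x + \<delta>2 x"
  by (rule LieDer_pair_sum)

abbreviation "cochain \<equiv> p1.cochain"
abbreviation "T1 \<equiv> p1.T"
abbreviation "T2 \<equiv> p2.T"

text \<open>Expand the square of \<open>T1 + T2\<close>, the operator of the sum pair, and remove
  the two pure squares.\<close>

lemma T_mixed:
  assumes "cochain m c"
  shows "T1 (Suc m) (T2 m c) + T2 (Suc m) (T1 m c) = 0"
proof -
  have "p12.T (Suc m) (p12.T m c) = 0"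
    by (rule p12.T_T[OF assms])
  then show ?thesis
    using assms p1.T_T[OF assms] p2.T_T[OF assms]
    by (simp add: p1.layer_add_left p1.cochain_add p1.cochain_T p2.cochain_T p1.T_add p2.T_add)
qed

text \<open>
  Entries of the \<open>n\<close>-tuple, counted from 1 and extended by 0: with this convention the first and
  last entries of the coboundary follow the same formula as the others.
\<close>

definition pad :: "('v form \<times> 'v form) list \<Rightarrow> nat \<Rightarrow> 'v form \<times> 'v form"
  where "pad c j = (if 0 < j \<and> j \<le> length c then c ! (j - 1) else 0)"

abbreviation D :: "nat \<Rightarrow> ('v form \<times> 'v form) list \<Rightarrow> ('v form \<times> 'v form) list"
  where "D \<equiv> d_CLDP scale br1 br2 \<delta>1 \<delta>2"

lemma cochain_pad: "c \<in> C_CLD scale (Suc m) \<Longrightarrow> cochain m (pad c j)"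
  by (auto simp: C_CLD_def pad_def intro!: p1.C_LieDer_cochain)

lemma length_D: "length (D (Suc m) c) = Suc (Suc m)"
  by (cases m) (simp_all add: d_CLDP_def Let_def del: upt_Suc)

lemma nth_D:
  assumes c: "c \<in> C_CLD scale (Suc m)" and j: "j \<le> Suc m"
  shows "D (Suc m) c ! j = T2 m (pad c j) + T1 m (pad c (Suc j))"
proof (cases "m = 0")
  case True
  obtain f g where c': "c = [(f, g)]" "(f, g) \<in> C_LieDer scale (Suc 0)"
    using c True by (auto simp: C_CLD_def length_Suc_conv)
  then have g: "g = 0"
    by (auto simp: C_LieDer_def)
  note co = p1.C_LieDer_cochain[OF c'(2)]
  have "T1 0 (f, 0) = (NR_bracket scale 1 0 (form2 br1) f, - NR_bracket scale 0 0 f (form1 \<delta>1))"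
    "T2 0 (f, 0) = (NR_bracket scale 1 0 (form2 br2) f, - NR_bracket scale 0 0 f (form1 \<delta>2))"
    using p1.T_NR[OF co] p2.T_NR[OF co] by (simp_all add: prod_eq_iff g p1.sform_simps)
  then show ?thesis
    using True j by (auto simp: d_CLDP_def Let_def pad_def c' g le_Suc_eq)
next
  case False
  have len: "length c = Suc m"
    using c by (simp add: C_CLD_def)
  have co: "cochain m (c ! i)" if "i \<le> m" for i
    using cochain_pad[OF c, of "Suc i"] that len by (simp add: pad_def)
  let ?s = "p1.sform ((- 1) ^ m)"
  have T: "T1 m (c ! i) = (?s (NR_bracket scale 1 m (form2 br1) (fst (c ! i))),
      ?s (- NR_bracket scale 1 (m - 1) (form2 br1) (snd (c ! i))
        - NR_bracket scale m 0 (fst (c ! i)) (form1 \<delta>1)))"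
    "T2 m (c ! i) = (?s (NR_bracket scale 1 m (form2 br2) (fst (c ! i))),
      ?s (- NR_bracket scale 1 (m - 1) (form2 br2) (snd (c ! i))
        - NR_bracket scale m 0 (fst (c ! i)) (form1 \<delta>2)))" if "i \<le> m" for i
    using p1.T_NR[of m "fst (c ! i)" "snd (c ! i)"] p2.T_NR[of m "fst (c ! i)" "snd (c ! i)"]
      co[OF that] False by (simp_all add: prod_eq_iff)
  \<comment> \<open>First, middle and last entry; position \<open>Suc k\<close> of the list is the
    entry with index \<open>k + 2\<close>.\<close>
  consider "j = 0" | k where "j = Suc k" "k < m" | "j = Suc m"
    using j by (cases j) (auto simp: le_less)
  then show ?thesis
  proof cases
    case 1
    then show ?thesis
      using False T(1)[of 0] len by (simp add: d_CLDP_def Let_def pad_def)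
  next
    case 2
    then show ?thesis
      using False T(1)[of j] T(2)[of k] len
      by (simp add: d_CLDP_def Let_def pad_def nth_append p1.sform_simps algebra_simps del: upt_Suc)
  next
    case 3
    then show ?thesis
      using False T(2)[of m] len
      by (simp add: d_CLDP_def Let_def pad_def nth_append del: upt_Suc)
  qed
qed

text \<open>Holds for all \<open>j\<close>: past the last entry both sides are 0.\<close>

lemma pad_D:
  assumes "c \<in> C_CLD scale (Suc m)"
  shows "pad (D (Suc m) c) (Suc j) = T2 m (pad c j) + T1 m (pad c (Suc j))"
  using nth_D[OF assms, of j] assms by (auto simp: pad_def length_D C_CLD_def)

lemma D_C_CLD:
  assumes "c \<in> C_CLD scale (Suc m)"
  shows "D (Suc m) c \<in> C_CLD scale (Suc (Suc m))"
proof -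
  have "D (Suc m) c ! j \<in> C_LieDer scale (Suc (Suc m))" if "j \<le> Suc m" for j
    unfolding nth_D[OF assms that]
    by (intro p1.cochain_C_LieDer p1.cochain_add p1.cochain_T p2.cochain_T cochain_pad assms)
  then show ?thesis
    unfolding C_CLD_def by (simp add: length_D set_conv_nth less_Suc_eq_le subset_iff) metis
qed

text \<open>Entry \<open>j\<close> collects \<open>T2 T2\<close> at \<open>j - 1\<close>,
  \<open>T1 T1\<close> at \<open>j + 1\<close> and the mixed terms at \<open>j\<close>, which vanish
  by \<open>T_T\<close> and \<open>T_mixed\<close>.\<close>

lemma D_D:
  assumes c: "c \<in> C_CLD scale (Suc m)"
  shows "D (Suc (Suc m)) (D (Suc m) c) = replicate (Suc (Suc (Suc m))) 0"
proof (rule nth_equalityI)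
  fix j
  assume "j < length (D (Suc (Suc m)) (D (Suc m) c))"
  then have j: "j \<le> Suc (Suc m)"
    by (simp add: length_D)
  note co = cochain_pad[OF c]
  have "T2 (Suc m) (pad (D (Suc m) c) j) + T1 (Suc m) (pad (D (Suc m) c) (Suc j)) = 0"
  \<comment> \<open>At \<open>j = 0\<close> the padding of the inner coboundary is 0 by convention,
    outside the scope of \<open>pad_D\<close>.\<close>
  proof (cases j)
    case 0
    have "pad x 0 = 0" for x by (simp add: pad_def)
    then show ?thesis
      using 0 pad_D[OF c, of 0] p1.T_T[OF co] by simp
  next
    case (Suc i)
    have "T2 (Suc m) (pad (D (Suc m) c) j) + T1 (Suc m) (pad (D (Suc m) c) (Suc j)) =
        T2 (Suc m) (T1 m (pad c j)) + T1 (Suc m) (T2 m (pad c j))"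
      using Suc pad_D[OF c, of i] pad_D[OF c, of j] p1.T_T[OF co] p2.T_T[OF co]
      by (simp add: p1.T_add p2.T_add)
    then show ?thesis
      using T_mixed[OF co, of j] by (simp add: add.commute)
  qed
  then show "D (Suc (Suc m)) (D (Suc m) c) ! j = replicate (Suc (Suc (Suc m))) 0 ! j"
    using nth_D[OF D_C_CLD[OF c] j] j by (simp del: replicate_Suc)
qed (simp add: length_D)

end

theorem theorem6p2:
  fixes scale :: "'k::field_char_0 \<Rightarrow> 'v::ab_group_add \<Rightarrow> 'v"
    and br1 br2 :: "'v \<Rightarrow> 'v \<Rightarrow> 'v"
    and \<delta>1 \<delta>2 :: "'v \<Rightarrow> 'v"
  assumes "compatible_LieDer_pair scale br1 br2 \<delta>1 \<delta>2"
  shows "\<forall>n\<ge>1. \<forall>c \<in> C_CLD scale n.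
           d_CLDP scale br1 br2 \<delta>1 \<delta>2 n c \<in> C_CLD scale (n + 1) \<and>
           d_CLDP scale br1 br2 \<delta>1 \<delta>2 (n + 1) (d_CLDP scale br1 br2 \<delta>1 \<delta>2 n c) =
             replicate (n + 2) 0"
proof (intro allI ballI impI)
  interpret compatible_LieDer_pair scale br1 br2 \<delta>1 \<delta>2
    by (rule assms)
  fix n :: nat and c
  assume "n \<ge> 1" and c: "c \<in> C_CLD scale n"
  then obtain m where n: "n = Suc m"
    by (cases n) auto
  show "D n c \<in> C_CLD scale (n + 1) \<and> D (n + 1) (D n c) = replicate (n + 2) 0"
    using D_C_CLD[OF c[unfolded n]] D_D[OF c[unfolded n]] by (simp add: n del: replicate_Suc)
qed

end
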